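(* Let $k\ge0$ be an integer. Points $p\in\mathcal{T}_k^\vee\setminus D_k$ classify isomorphism classes of data $(A,\epsilon,t_1,t_2)$ consisting of a commutative Frobenius algebra $A$ over $\mathbb{C}$ of dimension $k$ with a non-degenerate trace $\epsilon$ and generators $t_1,t_2$ of $A$. (The point $p$ corresponds to the algebra $A_{\pi(p)}$ with trace $\alpha_p$ and generators the images of $T_1,T_2$.)
   Context: The ground field is $\mathbb{C}$; points of varieties are $\mathbb{C}$-points. $H^k=\mathrm{Hilb}^k(\mathbb{C}^2)$ is the Hilbert scheme of codimension $k$ ideals of $\mathbb{C}[T_1,T_2]$. $\mathcal{T}_k\to H^k$ is the tautological bundle, with fiber $\mathbb{C}[T_1,T_2]/I$ over $I$, and $\pi:\mathcal{T}_k^\vee\to H^k$ is the dual bundle, so a point $p\in\mathcal{T}_k^\vee$ is an ideal $I_{\pi(p)}$ of codimension $k$ together with a linear functional $\alpha_p$ on $A_{\pi(p)}=\mathbb{C}[T_1,T_2]/I_{\pi(p)}$, also viewed as a functional on $\mathbb{C}[T_1,T_2]$. Let $I_p=\{z\in\mathbb{C}[T_1,T_2]:\alpha_p(zf)=0\ \forall f\in\mathbb{C}[T_1,T_2]\}$, the largest ideal contained in $\ker\alpha_p\subset\mathbb{C}[T_1,T_2]$; it contains $I_{\pi(p)}$. Put $D_k=\{p\in\mathcal{T}_k^\vee: I_{\pi(p)}\ne I_p\}$. A trace $\epsilon:A\to\mathbb{C}$ is a linear functional, non-degenerate if the form $(x,y)\mapsto\epsilon(xy)$ is non-degenerate. "Generators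 $t_1,t_2$" means $A$ is generated by $t_1,t_2$ as a unital $\mathbb{C}$-algebra. Isomorphisms of data are algebra isomorphisms preserving the trace and each of the two generators. *)

theory Defs
  imports
    "HOL-Algebra.Algebraic_Closure_Type"
    "Jordan_Normal_Form.Missing_VectorSpace"
begin

section \<open>Commutative algebras with a trace and two generators\<close>

abbreviation complex_field :: "complex ring"
  where "complex_field \<equiv> ring_of_type_algebra"

definition has_dimension :: "(complex, 'a, 'm) module_scheme \<Rightarrow> nat \<Rightarrow> bool"
  where "has_dimension V k \<longleftrightarrow>
    vectorspace.fin_dim complex_field V \<and> vectorspace.dim complex_field V = k"

definition linear_functional :: "(complex, 'a, 'm) module_scheme \<Rightarrow> ('a \<Rightarrow> complex) \<Rightarrow> bool"
  where "linear_functional V \<alpha> \<longleftrightarrow>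
    (\<forall>x\<in>carrier V. \<forall>y\<in>carrier V. \<alpha> (x \<oplus>\<^bsub>V\<^esub> y) = \<alpha> x + \<alpha> y) \<and>
    (\<forall>c. \<forall>x\<in>carrier V. \<alpha> (c \<odot>\<^bsub>V\<^esub> x) = c * \<alpha> x)"

text \<open>One-sided non-degeneracy suffices, as this is only used for commutative algebras.\<close>

definition nondegenerate_trace :: "(complex, 'a, 'm) module_scheme \<Rightarrow> ('a \<Rightarrow> complex) \<Rightarrow> bool"
  where "nondegenerate_trace A \<epsilon> \<longleftrightarrow> linear_functional A \<epsilon> \<and>
    (\<forall>x\<in>carrier A. (\<forall>y\<in>carrier A. \<epsilon> (x \<otimes>\<^bsub>A\<^esub> y) = 0) \<longrightarrow> x = \<zero>\<^bsub>A\<^esub>)"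

text \<open>\<^const>\<open>subring\<close> includes containing the unit, so these are the unital subalgebras.\<close>

definition unital_subalgebra :: "(complex, 'a, 'm) module_scheme \<Rightarrow> 'a set \<Rightarrow> bool"
  where "unital_subalgebra A B \<longleftrightarrow> subring B A \<and> (\<forall>c. \<forall>b\<in>B. c \<odot>\<^bsub>A\<^esub> b \<in> B)"

definition generates_algebra :: "(complex, 'a, 'm) module_scheme \<Rightarrow> 'a set \<Rightarrow> bool"
  where "generates_algebra A S \<longleftrightarrow> S \<subseteq> carrier A \<and>
    (\<forall>B. unital_subalgebra A B \<and> S \<subseteq> B \<longrightarrow> B = carrier A)"

record 'a trace_datum = "(complex, 'a) module" +
  tr :: "'a \<Rightarrow> complex"
  gen1 :: 'a
  gen2 :: 'a

text \<open>The zero algebra is allowed; it is the case \<^term>\<open>k = (0::nat)\<close>.\<close>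

definition frobenius_datum :: "nat \<Rightarrow> 'a trace_datum \<Rightarrow> bool"
  where "frobenius_datum k A \<longleftrightarrow>
    algebra complex_field A \<and> has_dimension A k \<and>
    nondegenerate_trace A (tr A) \<and> generates_algebra A {gen1 A, gen2 A}"

definition datum_isomorphism :: "'a trace_datum \<Rightarrow> 'b trace_datum \<Rightarrow> ('a \<Rightarrow> 'b) \<Rightarrow> bool"
  where "datum_isomorphism A B \<phi> \<longleftrightarrow>
    \<phi> \<in> ring_iso A B \<and>
    (\<forall>c. \<forall>x\<in>carrier A. \<phi> (c \<odot>\<^bsub>A\<^esub> x) = c \<odot>\<^bsub>B\<^esub> \<phi> x) \<and>
    (\<forall>x\<in>carrier A. tr B (\<phi> x) = tr A x) \<and>
    \<phi> (gen1 A) = gen1 B \<and> \<phi> (gen2 A) = gen2 B"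

definition isomorphic_data :: "'a trace_datum \<Rightarrow> 'b trace_datum \<Rightarrow> bool"
  where "isomorphic_data A B \<longleftrightarrow> (\<exists>\<phi>. datum_isomorphism A B \<phi>)"

definition datum_iso_rel :: "nat \<Rightarrow> ('a trace_datum \<times> 'a trace_datum) set"
  where "datum_iso_rel k =
    {(A, B). frobenius_datum k A \<and> frobenius_datum k B \<and> isomorphic_data A B}"

lemma isomorphic_data_refl: "isomorphic_data A A"
  unfolding isomorphic_data_def datum_isomorphism_def
  by (rule exI[of _ id]) (auto simp: ring_iso_def ring_hom_def)

lemma isomorphic_data_trans:
  assumes "isomorphic_data A B" "isomorphic_data B C"
  shows "isomorphic_data A C"
proof -
  obtain f g where f: "datum_isomorphism A B f" and g: "datum_isomorphism B C g"
    using assms by (auto simp: isomorphic_data_def)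
  have fc: "f x \<in> carrier B" if "x \<in> carrier A" for x
    using f that by (auto simp: datum_isomorphism_def ring_iso_def ring_hom_def)
  have "g \<circ> f \<in> ring_iso A C"
    using f g ring_iso_set_trans unfolding datum_isomorphism_def by blast
  then have "datum_isomorphism A C (g \<circ> f)"
    using f g fc by (auto simp: datum_isomorphism_def)
  then show ?thesis by (auto simp: isomorphic_data_def)
qed

lemma isomorphic_data_sym:
  assumes A: "algebra complex_field A" and gens: "gen1 A \<in> carrier A" "gen2 A \<in> carrier A"
    and iso: "isomorphic_data A B"
  shows "isomorphic_data B A"
proof -
  interpret algebra complex_field A by fact
  obtain f where f: "datum_isomorphism A B f"
    using iso by (auto simp: isomorphic_data_def)
  define g where "g = inv_into (carrier A) f"
  have fi: "f \<in> ring_iso A B" and bij: "bij_betw f (carrier A) (carrier B)"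
    using f by (auto simp: datum_isomorphism_def ring_iso_def)
  have g_iso: "g \<in> ring_iso B A"
    unfolding g_def using ring_iso_set_sym[OF _ fi] A by (simp add: algebra_def cring_def)
  have gc: "g y \<in> carrier A" and fg: "f (g y) = y" if "y \<in> carrier B" for y
    using bij that unfolding g_def
    by (metis bij_betw_imp_surj_on inv_into_into, metis bij_betw_inv_into_right)
  have gf: "g (f x) = x" if "x \<in> carrier A" for x
    using bij that unfolding g_def by (rule bij_betw_inv_into_left)
  have "g (c \<odot>\<^bsub>B\<^esub> y) = c \<odot>\<^bsub>A\<^esub> g y" if y: "y \<in> carrier B" for c y
  proof -
    have "c \<odot>\<^bsub>B\<^esub> y = f (c \<odot>\<^bsub>A\<^esub> g y)"
      using f gc[OF y] fg[OF y] by (simp add: datum_isomorphism_def)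
    moreover have "c \<odot>\<^bsub>A\<^esub> g y \<in> carrier A"
      using gc[OF y] by (simp add: ring_of_type_algebra_def)
    ultimately show ?thesis by (simp add: gf)
  qed
  moreover have "tr A (g y) = tr B y" if "y \<in> carrier B" for y
    using f gc[OF that] fg[OF that] unfolding datum_isomorphism_def by metis
  moreover have "g (gen1 B) = gen1 A" "g (gen2 B) = gen2 A"
    using f gf gens unfolding datum_isomorphism_def by metis+
  ultimately show ?thesis
    using g_iso unfolding isomorphic_data_def datum_isomorphism_def by blast
qed

lemma equiv_datum_iso_rel: "equiv {A. frobenius_datum k A} (datum_iso_rel k)"
proof (rule equivI)
  show "refl_on {A. frobenius_datum k A} (datum_iso_rel k)"
    by (auto simp: refl_on_def datum_iso_rel_def isomorphic_data_refl)
  show "sym (datum_iso_rel k)"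
    by (rule symI)
       (auto simp: datum_iso_rel_def frobenius_datum_def generates_algebra_def
         intro: isomorphic_data_sym)
  show "trans (datum_iso_rel k)"
    by (rule transI) (auto simp: datum_iso_rel_def intro: isomorphic_data_trans)
qed (auto simp: datum_iso_rel_def)


section \<open>Points of the dual of the tautological bundle on the Hilbert scheme\<close>

text \<open>
  \<open>\<complex>[T\<^sub>1, T\<^sub>2]\<close> is represented as \<open>\<complex>[T\<^sub>1][T\<^sub>2]\<close>: the inner
  polynomial variable is \<open>T\<^sub>1\<close>, the outer one is \<open>T\<^sub>2\<close>.
\<close>

type_synonym poly2 = "complex poly poly"

abbreviation poly2_ring :: "poly2 ring"
  where "poly2_ring \<equiv> ring_of_type_algebra"

definition const2 :: "complex \<Rightarrow> poly2" where "const2 c = [:[:c:]:]"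
definition T1 :: poly2 where "T1 = [:[:0, 1:]:]"
definition T2 :: poly2 where "T2 = [:0, 1:]"

definition coset :: "poly2 set \<Rightarrow> poly2 \<Rightarrow> poly2 set"
  where "coset I f = I +>\<^bsub>poly2_ring\<^esub> f"

definition quotient_algebra :: "poly2 set \<Rightarrow> (complex, poly2 set) module"
  where "quotient_algebra I =
    ring.extend (poly2_ring Quot I)
      (module.fields (\<lambda>c x. coset I (const2 c) \<otimes>\<^bsub>poly2_ring Quot I\<^esub> x))"

lemma quotient_algebra_sel:
  "carrier (quotient_algebra I) = carrier (poly2_ring Quot I)"
  "x \<oplus>\<^bsub>quotient_algebra I\<^esub> y = x \<oplus>\<^bsub>poly2_ring Quot I\<^esub> y"
  "x \<otimes>\<^bsub>quotient_algebra I\<^esub> y = x \<otimes>\<^bsub>poly2_ring Quot I\<^esub> y"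
  "\<zero>\<^bsub>quotient_algebra I\<^esub> = \<zero>\<^bsub>poly2_ring Quot I\<^esub>"
  "\<one>\<^bsub>quotient_algebra I\<^esub> = \<one>\<^bsub>poly2_ring Quot I\<^esub>"
  "c \<odot>\<^bsub>quotient_algebra I\<^esub> x = coset I (const2 c) \<otimes>\<^bsub>poly2_ring Quot I\<^esub> x"
  by (simp_all add: quotient_algebra_def ring.defs module.defs)

definition hilbert_points :: "nat \<Rightarrow> poly2 set set"
  where "hilbert_points k = {I. ideal I poly2_ring \<and> has_dimension (quotient_algebra I) k}"

text \<open>
  A functional on \<open>\<complex>[T\<^sub>1, T\<^sub>2]/I\<close> is a HOL function on all sets of polynomials;
  \<^const>\<open>extensional\<close> fixes its irrelevant values outside the quotient, so that equality of
  pairs is equality of points.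
\<close>

type_synonym dual_point = "poly2 set \<times> (poly2 set \<Rightarrow> complex)"

definition dual_tautological_points :: "nat \<Rightarrow> dual_point set"
  where "dual_tautological_points k =
    (SIGMA I : hilbert_points k.
      {\<alpha> \<in> extensional (carrier (quotient_algebra I)). linear_functional (quotient_algebra I) \<alpha>})"

definition lifted_functional :: "dual_point \<Rightarrow> poly2 \<Rightarrow> complex"
  where "lifted_functional p f = snd p (coset (fst p) f)"

definition kernel_ideal :: "dual_point \<Rightarrow> poly2 set"
  where "kernel_ideal p = {z. \<forall>f. lifted_functional p (z * f) = 0}"

definition degenerate_points :: "nat \<Rightarrow> dual_point set"
  where "degenerate_points k = {p \<in> dual_tautological_points k. fst p \<noteq> kernel_ideal p}"

definition datum_of_point :: "dual_point \<Rightarrow> poly2 set trace_datum"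
  where "datum_of_point p =
    module.extend (quotient_algebra (fst p))
      (trace_datum.fields (snd p) (coset (fst p) T1) (coset (fst p) T2))"

lemma datum_of_point_sel:
  "carrier (datum_of_point p) = carrier (quotient_algebra (fst p))"
  "x \<oplus>\<^bsub>datum_of_point p\<^esub> y = x \<oplus>\<^bsub>quotient_algebra (fst p)\<^esub> y"
  "x \<otimes>\<^bsub>datum_of_point p\<^esub> y = x \<otimes>\<^bsub>quotient_algebra (fst p)\<^esub> y"
  "\<zero>\<^bsub>datum_of_point p\<^esub> = \<zero>\<^bsub>quotient_algebra (fst p)\<^esub>"
  "\<one>\<^bsub>datum_of_point p\<^esub> = \<one>\<^bsub>quotient_algebra (fst p)\<^esub>"
  "c \<odot>\<^bsub>datum_of_point p\<^esub> x = c \<odot>\<^bsub>quotient_algebra (fst p)\<^esub> x"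
  "tr (datum_of_point p) = snd p"
  "gen1 (datum_of_point p) = coset (fst p) T1"
  "gen2 (datum_of_point p) = coset (fst p) T2"
  by (simp_all add: datum_of_point_def module.defs trace_datum.defs)

end

theory Submission
  imports Defs
begin

text \<open>
  A point outside \<open>D\<^sub>k\<close> and a Frobenius datum \<open>(A, \<epsilon>, t\<^sub>1, t\<^sub>2)\<close> are both encoded by one
  functional \<open>\<tau>\<close> on \<open>\<complex>[T\<^sub>1, T\<^sub>2]\<close>. For a point, \<open>\<tau>\<close> is the lifted functional; for a
  datum it is \<open>\<epsilon> \<circ> h\<close>, where \<open>h\<close> is the only algebra homomorphism to \<open>A\<close> with
  \<open>h T\<^sub>i = t\<^sub>i\<close> (lemmas \<open>poly2_hom_exists\<close> and \<open>poly2_hom_unique\<close>).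

  Generation by \<open>t\<^sub>1, t\<^sub>2\<close> says that \<open>h\<close> is onto (\<open>generates_iff_surjective\<close>), so
  \<open>A\<close> is \<open>\<complex>[T\<^sub>1, T\<^sub>2]\<close> modulo the kernel of \<open>h\<close>. For onto \<open>h\<close>, the trace is
  non-degenerate exactly if this kernel is the largest ideal on which \<open>\<tau>\<close> vanishes
  (\<open>nondegenerate_iff_kernel\<close>). Applied to the quotient map of a point, the last fact turns
  the condition of lying outside \<open>D\<^sub>k\<close> into non-degeneracy of the trace; applied to a datum it
  shows that the kernel with the induced functional is such a point, with datum isomorphic
  to the given one (\<open>point_exists\<close>).

  For uniqueness, an isomorphism of data commutes with the homomorphisms from
  \<open>\<complex>[T\<^sub>1, T\<^sub>2]\<close>, so isomorphic data have the same \<open>\<tau>\<close> (\<open>lifted_functional_eq_trace\<close>),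
  and \<open>\<tau>\<close> determines the point: the ideal is the largest one inside \<open>ker \<tau>\<close>, and the
  functional on the quotient is the one that \<open>\<tau>\<close> induces (\<open>point_eqI\<close>).
\<close>

section \<open>Algebra homomorphisms out of the polynomial ring\<close>

lemma type_algebra_sel [simp]:
  "carrier (ring_of_type_algebra :: 'r::comm_ring_1 ring) = UNIV"
  "x \<oplus>\<^bsub>(ring_of_type_algebra :: 'r ring)\<^esub> y = x + y"
  "x \<otimes>\<^bsub>(ring_of_type_algebra :: 'r ring)\<^esub> y = x * y"
  "\<zero>\<^bsub>(ring_of_type_algebra :: 'r ring)\<^esub> = 0"
  "\<one>\<^bsub>(ring_of_type_algebra :: 'r ring)\<^esub> = 1"
  by (simp_all add: ring_of_type_algebra_def)

definition poly2_hom :: "(complex, 'a, 'm) module_scheme \<Rightarrow> (poly2 \<Rightarrow> 'a) \<Rightarrow> bool"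
  where "poly2_hom A h \<longleftrightarrow>
    h \<in> ring_hom poly2_ring A \<and> (\<forall>c f. h (const2 c * f) = c \<odot>\<^bsub>A\<^esub> h f)"

lemma poly2_homD:
  assumes "poly2_hom A h"
  shows "h f \<in> carrier A" "h (f + g) = h f \<oplus>\<^bsub>A\<^esub> h g" "h (f * g) = h f \<otimes>\<^bsub>A\<^esub> h g"
    "h 1 = \<one>\<^bsub>A\<^esub>" "h (const2 c * f) = c \<odot>\<^bsub>A\<^esub> h f"
  using assms by (auto simp: poly2_hom_def ring_hom_def)

lemma poly2_hom_zero:
  assumes alg: "algebra complex_field A" and hom: "poly2_hom A h"
  shows "h 0 = \<zero>\<^bsub>A\<^esub>"
proof -
  interpret A: cring A using alg by (simp add: algebra_def)
  have "h 0 \<oplus>\<^bsub>A\<^esub> h 0 = h 0"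
    using poly2_homD(2)[OF hom, of 0 0] by simp
  then show ?thesis
    using poly2_homD(1)[OF hom] by (metis A.add.r_cancel_one')
qed

lemma poly2_hom_uminus:
  assumes alg: "algebra complex_field A" and hom: "poly2_hom A h"
  shows "h (- f) = \<ominus>\<^bsub>A\<^esub> h f"
proof -
  interpret A: cring A using alg by (simp add: algebra_def)
  have "h (- f) \<oplus>\<^bsub>A\<^esub> h f = \<zero>\<^bsub>A\<^esub>"
    using poly2_homD(2)[OF hom, of "- f" f] poly2_hom_zero[OF assms] by simp
  then show ?thesis
    using poly2_homD(1)[OF hom] A.minus_equality by metis
qed

text \<open>
  Whatever holds for constants and both variables and is preserved by sums and products holds
  for all polynomials. This is the form in which uniqueness of homomorphisms and generation use
  that \<open>T\<^sub>1\<close> and \<open>T\<^sub>2\<close> generate the polynomial ring.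
\<close>
lemma poly2_induct [case_names const T1 T2 add mult]:
  assumes const: "\<And>c. P (const2 c)" and T1: "P T1" and T2: "P T2"
    and add: "\<And>f g. P f \<Longrightarrow> P g \<Longrightarrow> P (f + g)"
    and mult: "\<And>f g. P f \<Longrightarrow> P g \<Longrightarrow> P (f * g)"
  shows "P f"
proof -
  have inner: "P [:q:]" for q :: "complex poly"
  proof (induction q)
    case 0
    show ?case using const[of 0] by (simp add: const2_def)
  next
    case (pCons c q)
    have "[:pCons c q:] = const2 c + T1 * [:q:]"
      by (simp add: const2_def T1_def)
    then show ?case using add[OF const mult[OF T1 pCons.IH]] by simp
  qed
  show ?thesis
  proof (induction f)
    case 0
    show ?case using inner[of 0] by simp
  next
    case (pCons q f)
    have "pCons q f = [:q:] + T2 * f"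
      by (simp add: T2_def)
    then show ?case using add[OF inner mult[OF T2 pCons.IH]] by simp
  qed
qed

lemma poly2_hom_unique:
  assumes "poly2_hom A g" "poly2_hom A h" "g T1 = h T1" "g T2 = h T2"
  shows "g = h"
proof
  fix f
  show "g f = h f"
  proof (induction f rule: poly2_induct)
    case (const c)
    show ?case
      using poly2_homD(4,5)[OF assms(1)] poly2_homD(4,5)[OF assms(2)] by (metis mult.right_neutral)
  qed (simp_all add: assms poly2_homD(2,3)[OF assms(1)] poly2_homD(2,3)[OF assms(2)])
qed

text \<open>
  The source ring is a type and the target a carrier set, so this evaluation is not an instance of
  \<^const>\<open>poly\<close>. Leaving the coefficient ring arbitrary lets it be iterated once per variable.
\<close>
definition horner :: "('a, 'm) ring_scheme \<Rightarrow> ('r::comm_ring_1 \<Rightarrow> 'a) \<Rightarrow> 'a \<Rightarrow> 'r poly \<Rightarrow> 'a"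
  where "horner A h a p =
    fold_coeffs (\<lambda>c x. h c \<oplus>\<^bsub>A\<^esub> a \<otimes>\<^bsub>A\<^esub> x) p \<zero>\<^bsub>A\<^esub>"

lemma horner_ring_hom:
  fixes A (structure) and h :: "'r::comm_ring_1 \<Rightarrow> 'a"
  assumes "cring A" and h: "h \<in> ring_hom ring_of_type_algebra A" and a: "a \<in> carrier A"
  shows "horner A h a \<in> ring_hom ring_of_type_algebra A"
    and "horner A h a [:c:] = h c" and "horner A h a [:0, 1:] = a"
proof -
  interpret cring A by fact
  let ?H = "horner A h a"
  have hD [simp]: "h x \<in> carrier A" "h (x + y) = h x \<oplus> h y" "h (x * y) = h x \<otimes> h y" "h 1 = \<one>"
    for x y using h by (auto simp: ring_hom_def)
  have h0 [simp]: "h 0 = \<zero>"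
    using hD(2)[of 0 0] hD(1)[of 0] by (metis add.r_cancel_one' add_0)
  have H0 [simp]: "?H 0 = \<zero>"
    by (simp add: horner_def)
  have HC [simp]: "?H (pCons c p) = h c \<oplus> a \<otimes> ?H p" for c p
  proof (cases "c = 0 \<and> p = 0")
    case True
    then show ?thesis using a by simp
  next
    case False
    then show ?thesis by (cases "c = 0") (simp_all add: horner_def)
  qed
  have Hc [simp]: "?H p \<in> carrier A" for p
    by (induction p) (simp_all add: a)
  have add: "?H (p + q) = ?H p \<oplus> ?H q" for p q
    by (induction p q rule: poly_induct2) (simp_all add: a r_distr a_ac)
  have smult: "?H (smult c q) = h c \<otimes> ?H q" for c q
    by (induction q) (simp_all add: a r_distr m_ac)
  have "?H (p * q) = ?H p \<otimes> ?H q" for p q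
    by (induction p) (simp_all add: a add smult l_distr m_assoc)
  moreover show "?H [:c:] = h c" for c
    using a by simp
  ultimately show "?H \<in> ring_hom ring_of_type_algebra A"
    using add by (auto simp: ring_hom_def one_pCons a)
  show "?H [:0, 1:] = a"
    using a by simp
qed

text \<open>
  The universal property of \<open>\<complex>[T\<^sub>1][T\<^sub>2]\<close> comes from evaluating twice: first extend the
  structure map \<open>\<complex> \<rightarrow> A\<close> to \<open>\<complex>[T\<^sub>1]\<close>, then use the result on the coefficients of a polynomial
  in \<open>T\<^sub>2\<close>.
\<close>
lemma poly2_hom_exists:
  assumes alg: "algebra complex_field A" and ab: "a \<in> carrier A" "b \<in> carrier A"
  obtains h where "poly2_hom A h" "h T1 = a" "h T2 = b"
proof -
  interpret A: cring A using alg by (simp add: algebra_def)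
  interpret algebra complex_field A by fact
  define h0 where "h0 c = c \<odot>\<^bsub>A\<^esub> \<one>\<^bsub>A\<^esub>" for c
  define h1 where "h1 = horner A h0 a"
  define h where "h = horner A h1 b"
  have sc: "c \<odot>\<^bsub>A\<^esub> x \<in> carrier A" if "x \<in> carrier A" for c x
    using smult_closed[of c x] that by simp
  have s2: "(c \<odot>\<^bsub>A\<^esub> x) \<otimes>\<^bsub>A\<^esub> y = c \<odot>\<^bsub>A\<^esub> (x \<otimes>\<^bsub>A\<^esub> y)"
    if "x \<in> carrier A" "y \<in> carrier A" for c x y
    using smult_assoc2[of c x y] that by simp
  have h0: "h0 \<in> ring_hom complex_field A"
    using smult_l_distr[of _ _ "\<one>\<^bsub>A\<^esub>"] smult_assoc1[of _ _ "\<one>\<^bsub>A\<^esub>"] smult_one[of "\<one>\<^bsub>A\<^esub>"]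
    by (auto simp: ring_hom_def h0_def sc s2)
  have h1: "h1 \<in> ring_hom ring_of_type_algebra A" "h1 [:c:] = h0 c" "h1 [:0, 1:] = a" for c
    unfolding h1_def using horner_ring_hom[OF A.cring_axioms h0 ab(1)] by blast+
  have h: "h \<in> ring_hom ring_of_type_algebra A" "h [:q:] = h1 q" "h [:0, 1:] = b" for q
    unfolding h_def using horner_ring_hom[OF A.cring_axioms h1(1) ab(2)] by blast+
  have hc: "h f \<in> carrier A" and hm: "h (f * g) = h f \<otimes>\<^bsub>A\<^esub> h g" for f g
    using h(1) by (auto simp: ring_hom_def)
  have "h (const2 c * f) = c \<odot>\<^bsub>A\<^esub> h f" for c f
  proof -
    have "h (const2 c) = c \<odot>\<^bsub>A\<^esub> \<one>\<^bsub>A\<^esub>"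
      by (simp only: const2_def h h1 h0_def)
    then show ?thesis by (simp only: hm) (simp add: s2 hc)
  qed
  then have "poly2_hom A h"
    using h(1) by (simp add: poly2_hom_def)
  moreover have "h T1 = a" "h T2 = b"
    by (simp_all only: T1_def T2_def h h1)
  ultimately show thesis by (rule that)
qed

text \<open>
  The axioms of a commutative algebra are inherited along a surjective map that respects the
  operations. This gives them for a quotient and for its extension by a trace and
  generators, which are different records, in the same way.
\<close>
lemma algebra_of_surjective_poly2_hom:
  assumes hom: "poly2_hom A h" and zero: "h 0 = \<zero>\<^bsub>A\<^esub>" and surj: "range h = carrier A"
  shows "algebra complex_field A"
proof -
  note hD = poly2_homD[OF hom]
  have ops: "h f \<oplus>\<^bsub>A\<^esub> h g = h (f + g)" "h f \<otimes>\<^bsub>A\<^esub> h g = h (f * g)"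
    "\<one>\<^bsub>A\<^esub> = h 1" "\<zero>\<^bsub>A\<^esub> = h 0" "c \<odot>\<^bsub>A\<^esub> h f = h (const2 c * f)" for f g c
    using hD zero by auto
  have ex: "\<exists>f. x = h f" if "x \<in> carrier A" for x
    using that surj by auto
  have c2: "const2 (c + d) = const2 c + const2 d" "const2 (c * d) = const2 c * const2 d"
    "const2 1 = 1" for c d
    by (simp_all add: const2_def one_pCons)
  have ring: "cring A"
  proof (rule cringI)
    show "abelian_group A"
    proof (rule abelian_groupI)
      fix x assume "x \<in> carrier A"
      then obtain f where "x = h f" using ex by auto
      then have "h (- f) \<oplus>\<^bsub>A\<^esub> x = \<zero>\<^bsub>A\<^esub>" by (simp add: ops)
      then show "\<exists>y\<in>carrier A. y \<oplus>\<^bsub>A\<^esub> x = \<zero>\<^bsub>A\<^esub>" using hD(1) by blast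
    qed (auto dest!: ex simp: ops hD(1) algebra_simps)
    show "Group.comm_monoid A"
      by (rule comm_monoidI) (auto dest!: ex simp: ops hD(1) algebra_simps)
  qed (auto dest!: ex simp: ops algebra_simps)
  show ?thesis
    by (rule algebraI[OF cring_from_type_algebra ring])
       (auto dest!: ex simp: ops hD(1) c2 algebra_simps)
qed

text \<open>
  The image of \<open>h\<close> is the smallest unital subalgebra containing the images of the variables.
\<close>
lemma generates_iff_surjective:
  assumes alg: "algebra complex_field A" and hom: "poly2_hom A h"
  shows "generates_algebra A {h T1, h T2} \<longleftrightarrow> range h = carrier A"
proof
  interpret A: cring A using alg by (simp add: algebra_def)
  note hD = poly2_homD[OF hom]
  have "subring (range h) A"
  proof (rule A.subringI)
    show "\<one>\<^bsub>A\<^esub> \<in> range h" using hD(4) by (metis rangeI)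
  qed (auto simp: hD(1) simp flip: hD(2,3) poly2_hom_uminus[OF assms])
  then have "unital_subalgebra A (range h)"
    by (auto simp: unital_subalgebra_def simp flip: hD(5))
  then show "range h = carrier A" if "generates_algebra A {h T1, h T2}"
    using that by (auto simp: generates_algebra_def)
next
  note hD = poly2_homD[OF hom]
  assume surj: "range h = carrier A"
  have "B = carrier A" if B: "unital_subalgebra A B" and gens: "h T1 \<in> B" "h T2 \<in> B" for B
  proof -
    have sub: "subring B A" using B by (simp add: unital_subalgebra_def)
    have sc: "c \<odot>\<^bsub>A\<^esub> x \<in> B" if "x \<in> B" for c x
      using B that by (auto simp: unital_subalgebra_def)
    have "h f \<in> B" for f
    proof (induction f rule: poly2_induct)
      case (const c)
      show ?case
        using hD(5)[of c 1] hD(4) sc[OF subringE(3)[OF sub], of c] by simp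
    qed (use gens subringE(6,7)[OF sub] in \<open>auto simp: hD(2,3)\<close>)
    then have "carrier A \<subseteq> B" unfolding surj[symmetric] by (rule image_subsetI)
    with subringE(1)[OF sub] show ?thesis by (rule equalityI)
  qed
  then show "generates_algebra A {h T1, h T2}"
    using hD(1) by (auto simp: generates_algebra_def)
qed

lemma poly2_hom_comp_iso:
  assumes "poly2_hom A h" "datum_isomorphism A B \<phi>"
  shows "poly2_hom B (\<phi> \<circ> h)"
  using assms(2) poly2_homD[OF assms(1)]
  by (auto simp: poly2_hom_def datum_isomorphism_def ring_iso_def ring_hom_def)

text \<open>
  The left-hand set is the preimage under \<open>h\<close> of the radical of the form \<open>\<epsilon>(xy)\<close>, because \<open>h f\<close> runs
  through all of \<open>A\<close>. It always contains the kernel of \<open>h\<close>, and equals it exactly if the radical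
  is zero.
\<close>
lemma nondegenerate_iff_kernel:
  assumes alg: "algebra complex_field A" and hom: "poly2_hom A h"
    and surj: "range h = carrier A" and linear: "linear_functional A \<epsilon>"
  shows "nondegenerate_trace A \<epsilon> \<longleftrightarrow>
    {z. \<forall>f. \<epsilon> (h (z * f)) = 0} = {z. h z = \<zero>\<^bsub>A\<^esub>}"
proof -
  interpret A: cring A using alg by (simp add: algebra_def)
  interpret algebra complex_field A by fact
  note hD = poly2_homD[OF hom]
  have "0 \<odot>\<^bsub>A\<^esub> \<zero>\<^bsub>A\<^esub> = \<zero>\<^bsub>A\<^esub>"
    using smult_r_null[of 0] by simp
  moreover have "\<epsilon> (c \<odot>\<^bsub>A\<^esub> \<zero>\<^bsub>A\<^esub>) = c * \<epsilon> \<zero>\<^bsub>A\<^esub>" for c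
    using linear by (simp only: linear_functional_def A.zero_closed)
  ultimately have "\<epsilon> \<zero>\<^bsub>A\<^esub> = 0" by (metis mult_zero_left)
  then have "{z. h z = \<zero>\<^bsub>A\<^esub>} \<subseteq> {z. \<forall>f. \<epsilon> (h (z * f)) = 0}"
    by (simp add: hD(1,3) subset_iff)
  moreover have "nondegenerate_trace A \<epsilon> \<longleftrightarrow>
      (\<forall>z. (\<forall>f. \<epsilon> (h (z * f)) = 0) \<longrightarrow> h z = \<zero>\<^bsub>A\<^esub>)"
    using linear by (simp add: nondegenerate_trace_def hD(3) flip: surj)
  ultimately show ?thesis by blast
qed


section \<open>Invariance of the dimension\<close>

lemma algebra_vectorspace:
  "algebra complex_field A \<Longrightarrow> vectorspace complex_field A"
  using field_from_type_algebra
  by (auto simp: vectorspace_def algebra_def intro: field.axioms)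

lemma has_dimension_transport:
  assumes A: "algebra complex_field A" and B: "algebra complex_field B"
    and bij: "bij_betw \<phi> (carrier A) (carrier B)"
    and add: "\<And>x y. x \<in> carrier A \<Longrightarrow> y \<in> carrier A \<Longrightarrow> \<phi> (x \<oplus>\<^bsub>A\<^esub> y) = \<phi> x \<oplus>\<^bsub>B\<^esub> \<phi> y"
    and smult: "\<And>c x. x \<in> carrier A \<Longrightarrow> \<phi> (c \<odot>\<^bsub>A\<^esub> x) = c \<odot>\<^bsub>B\<^esub> \<phi> x"
    and dim: "has_dimension A k"
  shows "has_dimension B k"
proof -
  interpret A: vectorspace complex_field A by (rule algebra_vectorspace[OF A])
  interpret B: vectorspace complex_field B by (rule algebra_vectorspace[OF B])
  interpret linear_map complex_field A B \<phi>
    by unfold_locales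
       (use bij add smult in \<open>auto simp: module_hom_def bij_betw_def\<close>)
  show ?thesis
    using dim dim_eq surj_fin_dim bij by (auto simp: has_dimension_def bij_betw_def)
qed


section \<open>The datum of a point\<close>

context
  fixes I :: "poly2 set"
  assumes I: "ideal I poly2_ring"
begin

interpretation ideal I poly2_ring by (rule I)

lemma coset_eq_zero_iff: "coset I f = \<zero>\<^bsub>quotient_algebra I\<^esub> \<longleftrightarrow> f \<in> I"
proof -
  have "I +>\<^bsub>poly2_ring\<^esub> f = I \<longleftrightarrow> f \<in> I"
    using a_rcos_const[of f] a_rcos_self[of f] by auto
  then show ?thesis by (simp add: coset_def quotient_algebra_sel FactRing_def)
qed

lemma range_coset: "range (coset I) = carrier (quotient_algebra I)"
  by (auto simp: coset_def quotient_algebra_sel FactRing_def A_RCOSETS_def' a_r_coset_def)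

lemma poly2_hom_coset: "poly2_hom (quotient_algebra I) (coset I)"
  using rcos_ring_hom by (auto simp: poly2_hom_def ring_hom_def quotient_algebra_sel coset_def[abs_def])

lemma algebra_quotient: "algebra complex_field (quotient_algebra I)"
  using algebra_of_surjective_poly2_hom[OF poly2_hom_coset _ range_coset]
  using additive_subgroup.zero_closed[OF ideal.axioms(1)[OF I]] by (simp add: coset_eq_zero_iff)

end

lemma datum_of_point_ideal:
  assumes I: "ideal (fst p) poly2_ring"
  shows poly2_hom_datum: "poly2_hom (datum_of_point p) (coset (fst p))"
    and range_coset_datum: "range (coset (fst p)) = carrier (datum_of_point p)"
    and algebra_datum: "algebra complex_field (datum_of_point p)"
    and coset_datum_zero: "coset (fst p) f = \<zero>\<^bsub>datum_of_point p\<^esub> \<longleftrightarrow> f \<in> fst p"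
    and has_dimension_datum:
      "has_dimension (datum_of_point p) k \<longleftrightarrow> has_dimension (quotient_algebra (fst p)) k"
proof -
  show hom: "poly2_hom (datum_of_point p) (coset (fst p))"
    using poly2_hom_coset[OF I]
    unfolding poly2_hom_def ring_hom_def datum_of_point_sel .
  show surj: "range (coset (fst p)) = carrier (datum_of_point p)"
    by (simp add: datum_of_point_sel range_coset[OF I])
  show zero: "coset (fst p) f = \<zero>\<^bsub>datum_of_point p\<^esub> \<longleftrightarrow> f \<in> fst p" for f
    by (simp add: datum_of_point_sel coset_eq_zero_iff[OF I])
  have "0 \<in> fst p"
    using additive_subgroup.zero_closed[OF ideal.axioms(1)[OF I]] by simp
  with zero show alg: "algebra complex_field (datum_of_point p)"
    using algebra_of_surjective_poly2_hom[OF hom _ surj] by simp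
  show "has_dimension (datum_of_point p) k \<longleftrightarrow> has_dimension (quotient_algebra (fst p)) k"
    using has_dimension_transport[OF alg algebra_quotient[OF I], of id k]
      has_dimension_transport[OF algebra_quotient[OF I] alg, of id k]
    by (auto simp: datum_of_point_sel)
qed

lemma linear_functional_datum:
  "linear_functional (datum_of_point p) \<alpha> \<longleftrightarrow> linear_functional (quotient_algebra (fst p)) \<alpha>"
  by (simp add: linear_functional_def datum_of_point_sel)

lemma nondegenerate_pointD:
  assumes "p \<in> dual_tautological_points k - degenerate_points k"
  shows "ideal (fst p) poly2_ring" "has_dimension (quotient_algebra (fst p)) k"
    "linear_functional (quotient_algebra (fst p)) (snd p)"
    "snd p \<in> extensional (carrier (quotient_algebra (fst p)))"
    "kernel_ideal p = fst p"
  using assms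
  by (auto simp: dual_tautological_points_def hilbert_points_def degenerate_points_def)

lemma frobenius_datum_of_point:
  assumes p: "p \<in> dual_tautological_points k - degenerate_points k"
  shows "frobenius_datum k (datum_of_point p)"
proof -
  note pD = nondegenerate_pointD[OF p]
  note dD = datum_of_point_ideal[OF pD(1)]
  have "nondegenerate_trace (datum_of_point p) (snd p)"
    using nondegenerate_iff_kernel[OF dD(3,1,2), of "snd p"] pD(3,5)
    by (simp add: linear_functional_datum dD(4) kernel_ideal_def lifted_functional_def)
  moreover have "generates_algebra (datum_of_point p) {coset (fst p) T1, coset (fst p) T2}"
    using generates_iff_surjective[OF dD(3,1)] dD(2) by blast
  ultimately show ?thesis
    using dD pD(2) by (simp add: frobenius_datum_def datum_of_point_sel(7-9))
qed


section \<open>Recovering a point from its datum\<close>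

text \<open>
  An isomorphism carries the quotient map of \<open>p\<close> to a homomorphism with the values of \<open>h\<close> on the
  variables, hence to \<open>h\<close> itself; preservation of the trace does the rest.
\<close>
lemma lifted_functional_eq_trace:
  assumes I: "ideal (fst p) poly2_ring" and iso: "isomorphic_data (datum_of_point p) A"
    and h: "poly2_hom A h" "h T1 = gen1 A" "h T2 = gen2 A"
  shows "lifted_functional p f = tr A (h f)"
proof -
  obtain \<phi> where \<phi>: "datum_isomorphism (datum_of_point p) A \<phi>"
    using iso by (auto simp: isomorphic_data_def)
  note dD = datum_of_point_ideal[OF I]
  have "\<phi> \<circ> coset (fst p) = h"
    by (rule poly2_hom_unique[OF poly2_hom_comp_iso[OF dD(1) \<phi>] h(1)])
       (use \<phi> h(2,3) in \<open>auto simp: datum_isomorphism_def datum_of_point_sel\<close>)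
  then have "h f = \<phi> (coset (fst p) f)" by auto
  moreover have "coset (fst p) f \<in> carrier (datum_of_point p)"
    using dD(2) by auto
  ultimately show ?thesis
    using \<phi> by (simp add: datum_isomorphism_def lifted_functional_def datum_of_point_sel(7))
qed

text \<open>
  Away from \<open>D\<^sub>k\<close> the ideal of a point can be read off its lifted functional, because
  \<^const>\<open>kernel_ideal\<close> is defined from that functional alone. This fails on \<open>D\<^sub>k\<close>: points over
  different ideals can have the same lifted functional, such as zero.
\<close>
lemma point_eqI:
  assumes p: "p \<in> dual_tautological_points k - degenerate_points k"
    and q: "q \<in> dual_tautological_points k - degenerate_points k"
    and eq: "lifted_functional p = lifted_functional q"
  shows "p = q"
proof (rule prod_eqI)
  note pD = nondegenerate_pointD[OF p] and qD = nondegenerate_pointD[OF q]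
  have "kernel_ideal p = kernel_ideal q"
    using eq by (simp add: kernel_ideal_def)
  then show I: "fst p = fst q" using pD qD by simp
  show "snd p = snd q"
  proof (rule extensionalityI)
    show "snd p \<in> extensional (carrier (quotient_algebra (fst p)))"
      "snd q \<in> extensional (carrier (quotient_algebra (fst p)))"
      using pD(4) qD(4) I by auto
    fix u assume "u \<in> carrier (quotient_algebra (fst p))"
    then obtain f where "u = coset (fst p) f"
      using range_coset[OF pD(1)] by auto
    then show "snd p u = snd q u"
      using fun_cong[OF eq, of f] I by (simp add: lifted_functional_def)
  qed
qed

lemma point_unique:
  assumes A: "frobenius_datum k A"
    and p: "p \<in> dual_tautological_points k - degenerate_points k"
      "isomorphic_data (datum_of_point p) A"
    and q: "q \<in> dual_tautological_points k - degenerate_points k"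
      "isomorphic_data (datum_of_point q) A"
  shows "p = q"
proof -
  obtain h where h: "poly2_hom A h" "h T1 = gen1 A" "h T2 = gen2 A"
    using poly2_hom_exists[of A "gen1 A" "gen2 A"] A
    by (auto simp: frobenius_datum_def generates_algebra_def)
  have "lifted_functional p f = lifted_functional q f" for f
    using lifted_functional_eq_trace[OF nondegenerate_pointD(1)[OF p(1)] p(2) h]
      lifted_functional_eq_trace[OF nondegenerate_pointD(1)[OF q(1)] q(2) h] by simp
  then show ?thesis using point_eqI[OF p(1) q(1)] by blast
qed

text \<open>
  The point is the kernel of the evaluation \<open>h\<close> at the generators, with the trace pulled back
  along the isomorphism \<open>\<phi>\<close> of the quotient with \<open>A\<close>.
\<close>
lemma point_exists:
  assumes A: "frobenius_datum k A"
  obtains p where "p \<in> dual_tautological_points k - degenerate_points k"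
    "isomorphic_data (datum_of_point p) A"
proof -
  have alg: "algebra complex_field A" and dim: "has_dimension A k"
    and nd: "nondegenerate_trace A (tr A)" and gen: "generates_algebra A {gen1 A, gen2 A}"
    using A by (auto simp: frobenius_datum_def)
  interpret A: cring A using alg by (simp add: algebra_def)
  obtain h where h: "poly2_hom A h" "h T1 = gen1 A" "h T2 = gen2 A"
    using poly2_hom_exists[OF alg, of "gen1 A" "gen2 A"] gen by (auto simp: generates_algebra_def)
  note hD = poly2_homD[OF h(1)]
  have surj: "range h = carrier A"
    using generates_iff_surjective[OF alg h(1)] gen h by simp
  have hr: "ring_hom_ring poly2_ring A h"
    by (rule ring_hom_ringI2[OF ring_from_type_algebra A.ring_axioms])
      (use h(1) in \<open>simp add: poly2_hom_def\<close>)
  define I where "I = a_kernel poly2_ring A h"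
  have I_eq: "I = {z. h z = \<zero>\<^bsub>A\<^esub>}"
    by (simp add: I_def a_kernel_def')
  have I: "ideal I poly2_ring"
    unfolding I_def by (rule ring_hom_ring.kernel_is_ideal[OF hr])
  define \<phi> where "\<phi> u = the_elem (h ` u)" for u
  have \<phi>_coset: "\<phi> (coset I f) = h f" for f
    unfolding \<phi>_def coset_def I_def using ring_hom_ring.the_elem_simp[OF hr, of f] by simp
  define \<alpha> where "\<alpha> = restrict (\<lambda>u. tr A (\<phi> u)) (carrier (quotient_algebra I))"
  have cosetc: "coset I f \<in> carrier (quotient_algebra I)" for f
    using range_coset[OF I] by auto
  have \<alpha>_coset: "\<alpha> (coset I f) = tr A (h f)" for f
    by (simp add: \<alpha>_def \<phi>_coset cosetc)
  define p where "p = (I, \<alpha>)"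
  have fst_p [simp]: "fst p = I" and snd_p [simp]: "snd p = \<alpha>"
    by (simp_all add: p_def)
  note qD = poly2_homD[OF poly2_hom_coset[OF I]]
  have linear: "linear_functional A (tr A)"
    using nd by (simp add: nondegenerate_trace_def)
  have lin_\<alpha>: "linear_functional (quotient_algebra I) \<alpha>"
    using linear hD
    by (simp add: linear_functional_def \<alpha>_coset flip: range_coset[OF I] qD(2,5))
  note dD = datum_of_point_ideal[of p, simplified, OF I]
  have "\<phi> \<in> ring_iso (poly2_ring Quot I) A"
    unfolding I_def \<phi>_def[abs_def] by (rule ring_hom_ring.FactRing_iso_set[OF hr]) (simp add: surj)
  then have "\<phi> \<in> ring_iso (datum_of_point p) A"
    by (simp add: ring_iso_def ring_hom_def datum_of_point_sel quotient_algebra_sel)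
  moreover have "\<phi> (c \<odot>\<^bsub>datum_of_point p\<^esub> u) = c \<odot>\<^bsub>A\<^esub> \<phi> u"
    if "u \<in> carrier (datum_of_point p)" for c u
    using that poly2_homD(5)[OF dD(1)] hD(5)
    by (auto simp: \<phi>_coset simp flip: dD(2) poly2_homD(5)[OF dD(1)])
  ultimately have "datum_isomorphism (datum_of_point p) A \<phi>"
    using h by (auto simp: datum_isomorphism_def \<phi>_coset datum_of_point_sel \<alpha>_def)
  then have iso: "isomorphic_data (datum_of_point p) A"
    by (auto simp: isomorphic_data_def)
  have "gen1 (datum_of_point p) \<in> carrier (datum_of_point p)"
    "gen2 (datum_of_point p) \<in> carrier (datum_of_point p)"
    by (simp_all add: datum_of_point_sel cosetc)
  then obtain \<psi> where \<psi>: "datum_isomorphism A (datum_of_point p) \<psi>"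
    using isomorphic_data_sym[OF dD(3) _ _ iso] by (auto simp: isomorphic_data_def)
  have "has_dimension (datum_of_point p) k"
    by (rule has_dimension_transport[OF alg dD(3) _ _ _ dim, of \<psi>])
       (use \<psi> in \<open>auto simp: datum_isomorphism_def ring_iso_def ring_hom_def\<close>)
  then have "p \<in> dual_tautological_points k"
    using I lin_\<alpha> dD(5)
    by (simp add: p_def dual_tautological_points_def hilbert_points_def) (simp add: \<alpha>_def)
  moreover have "kernel_ideal p = I"
    using nondegenerate_iff_kernel[OF alg h(1) surj linear] nd
    by (simp add: kernel_ideal_def lifted_functional_def \<alpha>_coset) (simp add: I_eq)
  ultimately have "p \<in> dual_tautological_points k - degenerate_points k"
    by (simp add: degenerate_points_def)
  then show thesis using iso by (rule that)
qed

theorem proposition4p2: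
  fixes k :: nat
  shows
    "(\<forall>p \<in> dual_tautological_points k - degenerate_points k.
        frobenius_datum k (datum_of_point p)) \<and>
     bij_betw (\<lambda>p. datum_iso_rel k `` {datum_of_point p})
       (dual_tautological_points k - degenerate_points k)
       ({A :: poly2 set trace_datum. frobenius_datum k A} // datum_iso_rel k) \<and>
     (\<forall>A :: 'a trace_datum. frobenius_datum k A \<longrightarrow>
        (\<exists>!p. p \<in> dual_tautological_points k - degenerate_points k \<and>
              isomorphic_data (datum_of_point p) A))"
proof (intro conjI ballI allI impI)
  fix p assume "p \<in> dual_tautological_points k - degenerate_points k"
  then show "frobenius_datum k (datum_of_point p)" by (rule frobenius_datum_of_point)
next
  let ?P = "dual_tautological_points k - degenerate_points k"
  let ?F = "{A :: poly2 set trace_datum. frobenius_datum k A}"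
  let ?c = "\<lambda>p. datum_iso_rel k `` {datum_of_point p}"
  show "bij_betw ?c ?P (?F // datum_iso_rel k)"
    unfolding bij_betw_def
  proof
    show "inj_on ?c ?P"
    proof (rule inj_onI)
      fix p q assume p: "p \<in> ?P" and q: "q \<in> ?P" and eq: "?c p = ?c q"
      have F: "frobenius_datum k (datum_of_point q)"
        by (rule frobenius_datum_of_point[OF q])
      have "isomorphic_data (datum_of_point p) (datum_of_point q)"
        using eq_equiv_class[OF eq equiv_datum_iso_rel] F by (simp add: datum_iso_rel_def)
      then show "p = q"
        using point_unique[OF F p _ q isomorphic_data_refl] by blast
    qed
    show "?c ` ?P = ?F // datum_iso_rel k"
    proof
      show "?c ` ?P \<subseteq> ?F // datum_iso_rel k"
        using frobenius_datum_of_point by (auto intro!: quotientI)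
      show "?F // datum_iso_rel k \<subseteq> ?c ` ?P"
      proof
        fix u assume "u \<in> ?F // datum_iso_rel k"
        then obtain A where A: "frobenius_datum k A" and u: "u = datum_iso_rel k `` {A}"
          by (auto elim: quotientE)
        obtain p where p: "p \<in> ?P" "isomorphic_data (datum_of_point p) A"
          using point_exists[OF A] by blast
        then have "(datum_of_point p, A) \<in> datum_iso_rel k"
          using A frobenius_datum_of_point by (auto simp: datum_iso_rel_def)
        then have "?c p = u"
          unfolding u by (rule equiv_class_eq[OF equiv_datum_iso_rel])
        then show "u \<in> ?c ` ?P" using p(1) by blast
      qed
    qed
  qed
next
  fix A :: "'a trace_datum" assume A: "frobenius_datum k A"
  obtain p where p: "p \<in> dual_tautological_points k - degenerate_points k"
    "isomorphic_data (datum_of_point p) A"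
    by (rule point_exists[OF A])
  then show "\<exists>!p. p \<in> dual_tautological_points k - degenerate_points k \<and>
      isomorphic_data (datum_of_point p) A"
    using point_unique[OF A] by blast
qed

end
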